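(* Let $\Gamma,\Delta$ be finite multisets of formulas. For every propositional variable $p$ there exists a formula $\forall p(\Gamma;\Delta)$ such that: (i) $Var(\forall p(\Gamma;\Delta))\subseteq Var(\Gamma,\Delta)\setminus\{p\}$; (ii) $\vdash_{G_{GL}} \Gamma,\forall p(\Gamma;\Delta)\Rightarrow\Delta$; (iii) for all finite multisets of formulas $\Phi,\Psi$ not containing $p$: if $\vdash_{G_{GL}}\Phi,\Gamma\Rightarrow\Delta,\Psi$, then $\vdash_{G_{GL}}\Phi\Rightarrow\forall p(\Gamma;\Delta),\Psi$.
   Context: Formulas are built from propositional variables and $\bot$ by $\neg,\wedge,\vee,\Box$; $Var(\cdot)$ denotes the set of propositional variables occurring. A sequent is $\Gamma\Rightarrow\Delta$ with $\Gamma,\Delta$ finite multisets of formulas; $\Box\Gamma$ is the multiset obtained by prefixing each element of $\Gamma$ with $\Box$. The sequent calculus $G_{GL}$ has axioms $\Gamma,p\Rightarrow p,\Delta$ ($p$ a propositional variable) and $\Gamma,\bot\Rightarrow\Delta$, and rules: $\wedge$-l: from $\Gamma,\alpha,\beta\Rightarrow\Delta$ infer $\Gamma,\alpha\wedge\beta\Rightarrow\Delta$; $\vee$-r: from $\Gamma\Rightarrow\alpha,\beta,\Delta$ infer $\Gamma\Rightarrow\alpha\vee\beta,\Delta$; $\neg$-r: from $\Gamma,\alpha\Rightarrow\Delta$ infer $\Gamma\Rightarrow\neg\alpha,\Delta$; $\neg$-l: from $\Gamma\Rightarrow\alpha,\Delta$ infer $\Gamma,\neg\alpha\Rightarrow\Delta$;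 $\wedge$-r: from $\Gamma\Rightarrow\alpha,\Delta$ and $\Gamma\Rightarrow\beta,\Delta$ infer $\Gamma\Rightarrow\alpha\wedge\beta,\Delta$; $\vee$-l: from $\Gamma,\alpha\Rightarrow\Delta$ and $\Gamma,\beta\Rightarrow\Delta$ infer $\Gamma,\alpha\vee\beta\Rightarrow\Delta$; $\Box_{GL}$: from $\Box\Gamma,\Gamma,\Box\alpha\Rightarrow\alpha$ infer $\Box\Gamma,\Pi\Rightarrow\Box\alpha,\Delta$, where $\Pi$ contains only propositional variables and $\Delta$ contains only propositional variables and boxed formulas. $\vdash_{G_{GL}} S$ means $S$ has a proof (finite tree of rule instances with axioms at leaves) in $G_{GL}$ (without cut).
   Formalization: In the rule Box_GL the right context Δ may also contain ⊥ (besides propositional variables and boxed formulas); with the literal side condition ⊥ in a succedent blocks the rule for good and the theorem fails. *)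

theory Defs
  imports "HOL-Library.Multiset"
begin

datatype (Var: 'v) fm =
    PVar 'v
  | Bot  ("\<^bold>\<bottom>")
  | Neg "'v fm"  ("\<^bold>\<not> _" [90] 90)
  | And "'v fm" "'v fm"  (infixr "\<^bold>\<and>" 80)
  | Or "'v fm" "'v fm"  (infixr "\<^bold>\<or>" 75)
  | Box "'v fm"  ("\<^bold>\<box> _" [90] 90)

definition Vars :: "'v fm multiset \<Rightarrow> 'v set" where
  "Vars \<Gamma> = (\<Union>\<phi>\<in>set_mset \<Gamma>. Var \<phi>)"

definition Boxes :: "'v fm multiset \<Rightarrow> 'v fm multiset" where
  "Boxes \<Gamma> = image_mset Box \<Gamma>"

text \<open>
  In the modal rule the right context \<open>\<Delta>\<close> consists of propositional variables, the constant
  \<open>\<^bold>\<bottom>\<close> and boxed formulas. Admitting \<open>\<^bold>\<bottom>\<close> there is essential: no rule removes \<open>\<^bold>\<bottom>\<close> from a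
  succedent, so if \<open>\<Delta>\<close> were restricted to variables and boxed formulas, then already
  the sequent with antecedent \<open>\<^bold>\<box> q\<close> and succedent \<open>\<^bold>\<box> q, \<^bold>\<bottom>\<close> would be underivable (weakening fails,
  and the calculus is incomplete for GL), and uniform interpolation would be false: with
  \<open>\<alpha> = \<^bold>\<box> (\<^bold>\<bottom> \<^bold>\<or> \<^bold>\<box> q) \<^bold>\<or> p\<close> and \<open>\<gamma> = \<^bold>\<not> \<^bold>\<box> \<alpha> \<^bold>\<or> p\<close>, the sequent with antecedent \<open>\<^bold>\<box> \<alpha>, \<^bold>\<box> \<gamma>\<close> and
  succedent \<open>\<^bold>\<box> \<alpha>\<close> would have no interpolant for \<open>p\<close>. The left context \<open>\<Pi>\<close> does not need \<open>\<^bold>\<bottom>\<close>,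
  since a sequent with \<open>\<^bold>\<bottom>\<close> in its antecedent is an axiom.
\<close>

inductive GGL :: "'v fm multiset \<Rightarrow> 'v fm multiset \<Rightarrow> bool"  (infix "\<turnstile>\<^sub>G\<^sub>L" 50) where
  ax:    "\<Gamma> + {#PVar p#} \<turnstile>\<^sub>G\<^sub>L {#PVar p#} + \<Delta>"
| botL:  "\<Gamma> + {#\<^bold>\<bottom>#} \<turnstile>\<^sub>G\<^sub>L \<Delta>"
| andL:  "\<Gamma> + {#\<alpha>, \<beta>#} \<turnstile>\<^sub>G\<^sub>L \<Delta> \<Longrightarrow> \<Gamma> + {#\<alpha> \<^bold>\<and> \<beta>#} \<turnstile>\<^sub>G\<^sub>L \<Delta>"
| orR:   "\<Gamma> \<turnstile>\<^sub>G\<^sub>L {#\<alpha>, \<beta>#} + \<Delta> \<Longrightarrow> \<Gamma> \<turnstile>\<^sub>G\<^sub>L {#\<alpha> \<^bold>\<or> \<beta>#} + \<Delta>"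
| negR:  "\<Gamma> + {#\<alpha>#} \<turnstile>\<^sub>G\<^sub>L \<Delta> \<Longrightarrow> \<Gamma> \<turnstile>\<^sub>G\<^sub>L {#\<^bold>\<not> \<alpha>#} + \<Delta>"
| negL:  "\<Gamma> \<turnstile>\<^sub>G\<^sub>L {#\<alpha>#} + \<Delta> \<Longrightarrow> \<Gamma> + {#\<^bold>\<not> \<alpha>#} \<turnstile>\<^sub>G\<^sub>L \<Delta>"
| andR:  "\<Gamma> \<turnstile>\<^sub>G\<^sub>L {#\<alpha>#} + \<Delta> \<Longrightarrow> \<Gamma> \<turnstile>\<^sub>G\<^sub>L {#\<beta>#} + \<Delta> \<Longrightarrow> \<Gamma> \<turnstile>\<^sub>G\<^sub>L {#\<alpha> \<^bold>\<and> \<beta>#} + \<Delta>"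
| orL:   "\<Gamma> + {#\<alpha>#} \<turnstile>\<^sub>G\<^sub>L \<Delta> \<Longrightarrow> \<Gamma> + {#\<beta>#} \<turnstile>\<^sub>G\<^sub>L \<Delta> \<Longrightarrow> \<Gamma> + {#\<alpha> \<^bold>\<or> \<beta>#} \<turnstile>\<^sub>G\<^sub>L \<Delta>"
| boxGL: "Boxes \<Gamma> + \<Gamma> + {#\<^bold>\<box> \<alpha>#} \<turnstile>\<^sub>G\<^sub>L {#\<alpha>#} \<Longrightarrow>
          set_mset \<Pi> \<subseteq> range PVar \<Longrightarrow>
          set_mset \<Delta> \<subseteq> range PVar \<union> {\<^bold>\<bottom>} \<union> range Box \<Longrightarrow>
          Boxes \<Gamma> + \<Pi> \<turnstile>\<^sub>G\<^sub>L {#\<^bold>\<box> \<alpha>#} + \<Delta>"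

end

theory Submission
  imports Defs
begin

text \<open>
  The calculus is sound for transitive, conversely well-founded Kripke frames and complete for
  finite trees ordered by the proper-subtree relation. The interpolant is the negation of the
  disjunction of the depth-\<open>n\<close> bisimulation types, over the variables other than \<open>p\<close>, of all trees
  refuting the given sequent, where \<open>n = 2 b + 1\<close> and \<open>b\<close> is the number of its boxed subformulas.
  Property (iii) rests on an amalgamation (following Visser): if \<open>k\<close> is \<open>n\<close>-bisimilar to a refuting \<open>m\<close>,
  then suitable pairs \<open>(a, b)\<close> form a model whose point \<open>(k, m)\<close> is fully bisimilar to \<open>k\<close> except
  for \<open>p\<close> and satisfies the same subformulas of the sequent as \<open>m\<close>. The bisimulation depth required
  of a pair depends only on the number of boxed subformulas failing at \<open>b\<close>, which strictly drops
  at the maximal witnesses provided by Loeb's principle.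
\<close>

section \<open>Kripke semantics and soundness\<close>

fun sat :: "('w \<Rightarrow> 'w \<Rightarrow> bool) \<Rightarrow> ('w \<Rightarrow> 'v set) \<Rightarrow> 'w \<Rightarrow> 'v fm \<Rightarrow> bool" where
  "sat R V w (PVar q) \<longleftrightarrow> q \<in> V w"
| "sat R V w Bot \<longleftrightarrow> False"
| "sat R V w (Neg \<phi>) \<longleftrightarrow> \<not> sat R V w \<phi>"
| "sat R V w (And \<phi> \<psi>) \<longleftrightarrow> sat R V w \<phi> \<and> sat R V w \<psi>"
| "sat R V w (Or \<phi> \<psi>) \<longleftrightarrow> sat R V w \<phi> \<or> sat R V w \<psi>"
| "sat R V w (Box \<phi>) \<longleftrightarrow> (\<forall>v. R w v \<longrightarrow> sat R V v \<phi>)"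

definition refutes ::
  "('w \<Rightarrow> 'w \<Rightarrow> bool) \<Rightarrow> ('w \<Rightarrow> 'v set) \<Rightarrow> 'w \<Rightarrow> 'v fm multiset \<Rightarrow> 'v fm multiset \<Rightarrow> bool" where
  "refutes R V w \<Gamma> \<Delta> \<longleftrightarrow> (\<forall>\<phi>\<in>#\<Gamma>. sat R V w \<phi>) \<and> (\<forall>\<phi>\<in>#\<Delta>. \<not> sat R V w \<phi>)"

definition GL_frame :: "('w \<Rightarrow> 'w \<Rightarrow> bool) \<Rightarrow> bool" where
  "GL_frame R \<longleftrightarrow> transp R \<and> wfp (R\<inverse>\<inverse>)"

lemma GL_frame_trans: "GL_frame R \<Longrightarrow> R x y \<Longrightarrow> R y z \<Longrightarrow> R x z"
  unfolding GL_frame_def by (blast dest: transpD)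

text \<open>Loeb's principle. A refuting successor either satisfies \<open>Box \<phi>\<close> or
  sees another refuting world, which by transitivity is again a successor of \<open>w\<close>;
  converse well-foundedness ends the search.\<close>

lemma GL_frame_maximal_witness:
  assumes "GL_frame R" and "\<not> sat R V w (Box \<phi>)"
  obtains v where "R w v" "\<not> sat R V v \<phi>" "sat R V v (Box \<phi>)"
proof -
  have wf: "wfp (R\<inverse>\<inverse>)" using assms(1) by (simp add: GL_frame_def)
  have "\<exists>v. R w v \<and> \<not> sat R V v \<phi> \<and> sat R V v (Box \<phi>)" if "R w u" "\<not> sat R V u \<phi>" for u
    using wf that
  proof (induction u rule: wfp_induct_rule)
    case (less u)
    show ?case
    proof (cases "sat R V u (Box \<phi>)")
      case True
      then show ?thesis using less.prems by blast
    next
      case False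
      then obtain u' where u': "R u u'" "\<not> sat R V u' \<phi>" by auto
      then show ?thesis
        using less.IH GL_frame_trans[OF assms(1) less.prems(1)] by blast
    qed
  qed
  then show thesis using assms(2) that by auto
qed

text \<open>Stated for arbitrary GL frames, not only for trees, because the amalgamated countermodel
  is a frame of pairs.\<close>

theorem GGL_sound:
  assumes "\<Gamma> \<turnstile>\<^sub>G\<^sub>L \<Delta>" and "GL_frame R"
  shows "\<not> refutes R V w \<Gamma> \<Delta>"
  using assms(1)
proof (induction arbitrary: w rule: GGL.induct)
  case (boxGL \<Gamma> \<alpha> \<Pi> \<Delta>)
  show ?case
  proof
    assume ref: "refutes R V w (Boxes \<Gamma> + \<Pi>) ({#\<^bold>\<box> \<alpha>#} + \<Delta>)"
    then have "\<not> sat R V w (Box \<alpha>)"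
      unfolding refutes_def by auto
    then obtain v where v: "R w v" "\<not> sat R V v \<alpha>" "sat R V v (Box \<alpha>)"
      using GL_frame_maximal_witness[OF assms(2)] by blast
    have "refutes R V v (Boxes \<Gamma> + \<Gamma> + {#\<^bold>\<box> \<alpha>#}) {#\<alpha>#}"
      using ref v GL_frame_trans[OF assms(2) v(1)]
      by (auto simp: refutes_def Boxes_def ball_Un)
    then show False using boxGL.IH by blast
  qed
qed (auto simp: refutes_def)

section \<open>Completeness for finite trees\<close>

definition atomicL :: "'v fm multiset \<Rightarrow> bool" where
  "atomicL \<Gamma> \<longleftrightarrow> set_mset \<Gamma> \<subseteq> range PVar \<union> range Box"

definition atomicR :: "'v fm multiset \<Rightarrow> bool" where
  "atomicR \<Delta> \<longleftrightarrow> set_mset \<Delta> \<subseteq> range PVar \<union> {Bot} \<union> range Box"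

text \<open>Backward application of the propositional rules terminates. A property closed under them
  need only be checked for sequents with \<open>Bot\<close> on the left and for those that no
  propositional rule reduces.\<close>

lemma sequent_saturation_induct [case_names atomic bot andL orR negR negL andR orL]:
  assumes atomic: "\<And>\<Gamma> \<Delta>. atomicL \<Gamma> \<Longrightarrow> atomicR \<Delta> \<Longrightarrow> Q \<Gamma> \<Delta>"
    and bot: "\<And>\<Gamma> \<Delta>. Q (\<Gamma> + {#Bot#}) \<Delta>"
    and andL: "\<And>\<Gamma> \<Delta> \<alpha> \<beta>. Q (\<Gamma> + {#\<alpha>, \<beta>#}) \<Delta> \<Longrightarrow> Q (\<Gamma> + {#And \<alpha> \<beta>#}) \<Delta>"
    and orR: "\<And>\<Gamma> \<Delta> \<alpha> \<beta>. Q \<Gamma> ({#\<alpha>, \<beta>#} + \<Delta>) \<Longrightarrow> Q \<Gamma> ({#Or \<alpha> \<beta>#} + \<Delta>)"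
    and negR: "\<And>\<Gamma> \<Delta> \<alpha>. Q (\<Gamma> + {#\<alpha>#}) \<Delta> \<Longrightarrow> Q \<Gamma> ({#Neg \<alpha>#} + \<Delta>)"
    and negL: "\<And>\<Gamma> \<Delta> \<alpha>. Q \<Gamma> ({#\<alpha>#} + \<Delta>) \<Longrightarrow> Q (\<Gamma> + {#Neg \<alpha>#}) \<Delta>"
    and andR: "\<And>\<Gamma> \<Delta> \<alpha> \<beta>. Q \<Gamma> ({#\<alpha>#} + \<Delta>) \<Longrightarrow> Q \<Gamma> ({#\<beta>#} + \<Delta>) \<Longrightarrow> Q \<Gamma> ({#And \<alpha> \<beta>#} + \<Delta>)"
    and orL: "\<And>\<Gamma> \<Delta> \<alpha> \<beta>. Q (\<Gamma> + {#\<alpha>#}) \<Delta> \<Longrightarrow> Q (\<Gamma> + {#\<beta>#}) \<Delta> \<Longrightarrow> Q (\<Gamma> + {#Or \<alpha> \<beta>#}) \<Delta>"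
  shows "Q \<Gamma> \<Delta>"
proof -
  \<comment> \<open>Two parts of sizes s and t together weigh 2(s + t) + 2, one less than the binary
    formula they come from.\<close>
  define weight :: "'a fm multiset \<Rightarrow> nat" where "weight M = (\<Sum>\<phi>\<in>#M. 2 * size \<phi> + 1)" for M
  have [simp]: "weight {#} = 0" "weight (add_mset \<phi> M) = 2 * size \<phi> + 1 + weight M" for \<phi> M
    by (auto simp: weight_def)
  show ?thesis
  proof (induction "weight \<Gamma> + weight \<Delta>" arbitrary: \<Gamma> \<Delta> rule: less_induct)
    case less
    consider "atomicL \<Gamma>" "atomicR \<Delta>"
      | \<phi> where "\<phi> \<in># \<Gamma>" "\<phi> \<notin> range PVar \<union> range Box"
      | \<phi> where "\<phi> \<in># \<Delta>" "\<phi> \<notin> range PVar \<union> {Bot} \<union> range Box"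
      unfolding atomicL_def atomicR_def by blast
    then show ?case
    proof cases
      case 1
      then show ?thesis by (rule atomic)
    next
      case 2
      then obtain \<Gamma>' where \<Gamma>': "\<Gamma> = \<Gamma>' + {#\<phi>#}"
        by (metis add_mset_add_single mset_add)
      note IH = less[unfolded \<Gamma>']
      show ?thesis
        unfolding \<Gamma>'
      proof (cases \<phi>)
        case Bot
        then show "Q (\<Gamma>' + {#\<phi>#}) \<Delta>" using bot by simp
      next
        case (Neg \<alpha>)
        then show "Q (\<Gamma>' + {#\<phi>#}) \<Delta>" unfolding Neg by (intro negL IH) (simp add: Neg)
      next
        case (And \<alpha> \<beta>)
        then show "Q (\<Gamma>' + {#\<phi>#}) \<Delta>" unfolding And by (intro andL IH) (simp add: And)
      next
        case (Or \<alpha> \<beta>)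
        then show "Q (\<Gamma>' + {#\<phi>#}) \<Delta>" unfolding Or by (intro orL IH) (simp_all add: Or)
      qed (use 2 in auto)
    next
      case 3
      then obtain \<Delta>' where \<Delta>': "\<Delta> = {#\<phi>#} + \<Delta>'"
        by (metis add_mset_add_single mset_add union_commute)
      note IH = less[unfolded \<Delta>']
      show ?thesis
        unfolding \<Delta>'
      proof (cases \<phi>)
        case (Neg \<alpha>)
        then show "Q \<Gamma> ({#\<phi>#} + \<Delta>')" unfolding Neg by (intro negR IH) (simp add: Neg)
      next
        case (And \<alpha> \<beta>)
        then show "Q \<Gamma> ({#\<phi>#} + \<Delta>')" unfolding And by (intro andR IH) (simp_all add: And)
      next
        case (Or \<alpha> \<beta>)
        then show "Q \<Gamma> ({#\<phi>#} + \<Delta>')" unfolding Or by (intro orR IH) (simp add: Or)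
      qed (use 3 in auto)
    qed
  qed
qed

lemma atomicL_split:
  assumes "atomicL \<Gamma>"
  obtains \<Gamma>' \<Pi> where "\<Gamma> = Boxes \<Gamma>' + \<Pi>" "set_mset \<Pi> \<subseteq> range PVar"
proof -
  have "\<exists>\<Gamma>' \<Pi>. \<Gamma> = Boxes \<Gamma>' + \<Pi> \<and> set_mset \<Pi> \<subseteq> range PVar"
    using assms
  proof (induction \<Gamma>)
    case empty
    show ?case by (intro exI[of _ "{#}"]) (simp add: Boxes_def)
  next
    case (add \<phi> \<Gamma>)
    then obtain \<Gamma>' \<Pi> where *: "\<Gamma> = Boxes \<Gamma>' + \<Pi>" "set_mset \<Pi> \<subseteq> range PVar"
      by (auto simp: atomicL_def)
    consider \<psi> where "\<phi> = Box \<psi>" | q where "\<phi> = PVar q"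
      using add.prems by (auto simp: atomicL_def)
    then show ?case
    proof cases
      case 1
      with * show ?thesis
        by (intro exI[of _ "add_mset \<psi> \<Gamma>'"] exI[of _ \<Pi>]) (simp add: Boxes_def)
    next
      case 2
      with * show ?thesis
        by (intro exI[of _ \<Gamma>'] exI[of _ "add_mset \<phi> \<Pi>"]) simp
    qed
  qed
  then show thesis using that by blast
qed

lemma GGL_identity: "\<Gamma> + {#\<phi>#} \<turnstile>\<^sub>G\<^sub>L {#\<phi>#} + \<Delta>"
proof (induction \<phi> arbitrary: \<Gamma> \<Delta>)
  case (PVar q)
  show ?case by (rule GGL.ax)
next
  case Bot
  show ?case by (rule GGL.botL)
next
  case (Neg \<phi>)
  have "\<Gamma> + {#\<phi>#} \<turnstile>\<^sub>G\<^sub>L {#\<phi>#} + \<Delta>" by (rule Neg)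
  then have "(\<Gamma> + {#\<phi>#}) + {#Neg \<phi>#} \<turnstile>\<^sub>G\<^sub>L \<Delta>" by (rule GGL.negL)
  then have "(\<Gamma> + {#Neg \<phi>#}) + {#\<phi>#} \<turnstile>\<^sub>G\<^sub>L \<Delta>" by (simp add: add_mset_commute)
  then show ?case by (rule GGL.negR)
next
  case (And \<phi> \<psi>)
  have "(\<Gamma> + {#\<psi>#}) + {#\<phi>#} \<turnstile>\<^sub>G\<^sub>L {#\<phi>#} + \<Delta>" "(\<Gamma> + {#\<phi>#}) + {#\<psi>#} \<turnstile>\<^sub>G\<^sub>L {#\<psi>#} + \<Delta>"
    by (rule And)+
  then show ?case by (intro GGL.andR GGL.andL) (simp_all add: add_mset_commute)
next
  case (Or \<phi> \<psi>)
  have "\<Gamma> + {#\<phi>#} \<turnstile>\<^sub>G\<^sub>L {#\<phi>#} + ({#\<psi>#} + \<Delta>)" "\<Gamma> + {#\<psi>#} \<turnstile>\<^sub>G\<^sub>L {#\<psi>#} + ({#\<phi>#} + \<Delta>)"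
    by (rule Or)+
  then show ?case by (intro GGL.orR GGL.orL) (simp_all add: add_mset_commute)
next
  case (Box \<phi>)
  show ?case
  \<comment> \<open>The modal rule restricts its contexts, so the side formulas are first reduced by
    propositional rules.\<close>
  proof (induction \<Gamma> \<Delta> rule: sequent_saturation_induct)
    case (atomic \<Gamma> \<Delta>)
    obtain \<Gamma>' \<Pi> where \<Gamma>: "\<Gamma> = Boxes \<Gamma>' + \<Pi>" "set_mset \<Pi> \<subseteq> range PVar"
      using atomicL_split[OF atomic(1)] .
    \<comment> \<open>The induction hypothesis for \<open>\<phi>\<close>, with the rest of the modal
      premise as its context.\<close>
    have "(Boxes (\<Gamma>' + {#\<phi>#}) + \<Gamma>' + {#Box \<phi>#}) + {#\<phi>#} \<turnstile>\<^sub>G\<^sub>L {#\<phi>#} + {#}"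
      by (rule Box)
    then have "Boxes (\<Gamma>' + {#\<phi>#}) + (\<Gamma>' + {#\<phi>#}) + {#Box \<phi>#} \<turnstile>\<^sub>G\<^sub>L {#\<phi>#}"
      by (simp add: add_mset_commute)
    then have "Boxes (\<Gamma>' + {#\<phi>#}) + \<Pi> \<turnstile>\<^sub>G\<^sub>L {#Box \<phi>#} + \<Delta>"
      using \<Gamma>(2) atomic(2) unfolding atomicR_def by (rule GGL.boxGL)
    then show ?case by (simp add: \<Gamma> Boxes_def)
  next
    case (bot \<Gamma> \<Delta>)
    show ?case using GGL.botL[of "\<Gamma> + {#Box \<phi>#}"] by (simp add: add_mset_commute)
  next
    case (andL \<Gamma> \<Delta> \<alpha> \<beta>)
    then show ?case using GGL.andL[of "\<Gamma> + {#Box \<phi>#}" \<alpha> \<beta>] by (simp add: add_mset_commute)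
  next
    case (orR \<Gamma> \<Delta> \<alpha> \<beta>)
    then show ?case using GGL.orR[of _ \<alpha> \<beta> "{#Box \<phi>#} + \<Delta>"] by (simp add: add_mset_commute)
  next
    case (negR \<Gamma> \<Delta> \<alpha>)
    then show ?case using GGL.negR[of "\<Gamma> + {#Box \<phi>#}" \<alpha> "{#Box \<phi>#} + \<Delta>"]
      by (simp add: add_mset_commute)
  next
    case (negL \<Gamma> \<Delta> \<alpha>)
    then show ?case using GGL.negL[of "\<Gamma> + {#Box \<phi>#}" \<alpha> "{#Box \<phi>#} + \<Delta>"]
      by (simp add: add_mset_commute)
  next
    case (andR \<Gamma> \<Delta> \<alpha> \<beta>)
    then show ?case using GGL.andR[of _ \<alpha> "{#Box \<phi>#} + \<Delta>" \<beta>] by (simp add: add_mset_commute)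
  next
    case (orL \<Gamma> \<Delta> \<alpha> \<beta>)
    then show ?case using GGL.orL[of "\<Gamma> + {#Box \<phi>#}" \<alpha> _ \<beta>] by (simp add: add_mset_commute)
  qed
qed

section \<open>Finite labelled trees and subformulas\<close>

datatype 'v ltree = Node (label: "'v set") (kids: "'v ltree list")

definition child :: "'v ltree \<Rightarrow> 'v ltree \<Rightarrow> bool" where
  "child t s \<longleftrightarrow> s \<in> set (kids t)"

text \<open>All finite trees together are the worlds of one frame, valued by their root labels.
  Countermodels are thus worlds of a single fixed model and can be compared by bisimulation inside
  it.\<close>

abbreviation below :: "'v ltree \<Rightarrow> 'v ltree \<Rightarrow> bool" where
  "below \<equiv> child\<^sup>+\<^sup>+"

lemma child_size: "child t s \<Longrightarrow> size s < size t"
  by (cases t) (auto simp: child_def less_Suc_eq_le size_list_estimation' trans_le_add1)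

lemma GL_frame_below: "GL_frame below"
proof -
  have "size s < size t" if "below t s" for t s :: "'a ltree"
    using that by (induction) (auto dest: child_size)
  then have "wfp (below\<inverse>\<inverse> :: 'a ltree \<Rightarrow> _)"
    by (intro wfp_if_convertible_to_nat[where f = size]) auto
  then show ?thesis by (auto simp: GL_frame_def intro: transpI)
qed

lemma below_Node_iff: "below (Node L ts) s \<longleftrightarrow> (\<exists>t\<in>set ts. s = t \<or> below t s)"
proof
  assume "below (Node L ts) s"
  then show "\<exists>t\<in>set ts. s = t \<or> below t s"
    by (metis child_def ltree.sel(2) tranclpD rtranclpD)
next
  assume "\<exists>t\<in>set ts. s = t \<or> below t s"
  then show "below (Node L ts) s"
    by (metis child_def ltree.sel(2) tranclp.r_into_trancl tranclp_into_tranclp2)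
qed

fun subfms :: "'v fm \<Rightarrow> 'v fm set" where
  "subfms (PVar q) = {PVar q}"
| "subfms Bot = {Bot}"
| "subfms (Neg \<phi>) = insert (Neg \<phi>) (subfms \<phi>)"
| "subfms (And \<phi> \<psi>) = insert (And \<phi> \<psi>) (subfms \<phi> \<union> subfms \<psi>)"
| "subfms (Or \<phi> \<psi>) = insert (Or \<phi> \<psi>) (subfms \<phi> \<union> subfms \<psi>)"
| "subfms (Box \<phi>) = insert (Box \<phi>) (subfms \<phi>)"

definition Subfms :: "'v fm multiset \<Rightarrow> 'v fm set" where
  "Subfms \<Gamma> = (\<Union>\<phi>\<in>set_mset \<Gamma>. subfms \<phi>)"

lemma Subfms_simps [simp]:
  "Subfms {#} = {}" "Subfms (add_mset \<phi> \<Gamma>) = subfms \<phi> \<union> Subfms \<Gamma>"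
  "Subfms (\<Gamma> + \<Delta>) = Subfms \<Gamma> \<union> Subfms \<Delta>"
  by (auto simp: Subfms_def)

lemma subfms_refl [simp]: "\<phi> \<in> subfms \<phi>"
  by (cases \<phi>) auto

lemma finite_Subfms: "finite (Subfms \<Gamma>)"
proof -
  have "finite (subfms \<phi>)" for \<phi> :: "'a fm" by (induction \<phi>) auto
  then show ?thesis by (simp add: Subfms_def)
qed

text \<open>
  Backward proof search terminates because the modal rule adds its diagonal formula to the
  antecedent: \<open>n\<close> counts the boxed subformulas still missing there.
\<close>

lemma GGL_complete_bounded:
  assumes "finite S" and "Subfms \<Gamma> \<union> Subfms \<Delta> \<subseteq> S" and "card (S - set_mset \<Gamma> \<inter> range Box) \<le> n"
    and "\<And>t. \<not> refutes below label t \<Gamma> \<Delta>"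
  shows "\<Gamma> \<turnstile>\<^sub>G\<^sub>L \<Delta>"
  using assms(2-4)
proof (induction n arbitrary: \<Gamma> \<Delta> rule: less_induct)
  case (less n)
  \<comment> \<open>Read backwards, propositional rules keep the boxed formulas of the antecedent,
    so the bound survives them and falls only at the modal rule.\<close>
  have mono: "card (S - set_mset \<Gamma>' \<inter> range Box) \<le> n"
    if "card (S - set_mset \<Gamma> \<inter> range Box) \<le> n" "set_mset \<Gamma> \<inter> range Box \<subseteq> set_mset \<Gamma>'" for \<Gamma> \<Gamma>'
    by (rule order_trans[OF card_mono that(1)]) (use that(2) assms(1) in auto)
  show ?case
    using less.prems
  proof (induction \<Gamma> \<Delta> rule: sequent_saturation_induct)
    case (atomic \<Gamma> \<Delta>)
    obtain \<Gamma>' \<Pi> where \<Gamma>: "\<Gamma> = Boxes \<Gamma>' + \<Pi>" "set_mset \<Pi> \<subseteq> range PVar"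
      using atomicL_split[OF atomic(1)] .
    show ?case
    proof (cases "\<exists>\<phi>. \<phi> \<in># \<Gamma> \<and> \<phi> \<in># \<Delta>")
      case True
      then obtain \<phi> \<Gamma>1 \<Delta>1 where "\<Gamma> = \<Gamma>1 + {#\<phi>#}" "\<Delta> = {#\<phi>#} + \<Delta>1"
        by (metis add_mset_add_single mset_add union_commute)
      then show ?thesis by (simp only: GGL_identity)
    next
      case disjoint: False
      show ?thesis
      proof (rule ccontr)
        assume under: "\<not> \<Gamma> \<turnstile>\<^sub>G\<^sub>L \<Delta>"
        have "\<exists>t. refutes below label t (Boxes \<Gamma>' + \<Gamma>' + {#Box \<alpha>#}) {#\<alpha>#}"
          if mem: "Box \<alpha> \<in># \<Delta>" for \<alpha>
        proof (rule ccontr)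
          let ?\<Gamma> = "Boxes \<Gamma>' + \<Gamma>' + {#Box \<alpha>#}"
          assume none: "\<not> ?thesis"
          obtain \<Delta>' where \<Delta>': "\<Delta> = {#Box \<alpha>#} + \<Delta>'"
            using multi_member_split[OF mem] by auto
          \<comment> \<open>A box on both sides would be an identity, so the diagonal formula is new
            on the left and the count strictly drops.\<close>
          have new: "Box \<alpha> \<notin># \<Gamma>" using disjoint mem by blast
          have inS: "Box \<alpha> \<in> S" using atomic(3) by (simp add: \<Delta>')
          have "card (S - set_mset ?\<Gamma> \<inter> range Box) < card (S - set_mset \<Gamma> \<inter> range Box)"
            by (rule psubset_card_mono) (use assms(1) new inS \<Gamma> in \<open>auto simp: Boxes_def\<close>)
          moreover have "Subfms ?\<Gamma> \<union> Subfms {#\<alpha>#} \<subseteq> S"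
            using atomic(3) by (auto simp: \<Gamma>(1) \<Delta>' Boxes_def Subfms_def)
          ultimately have "?\<Gamma> \<turnstile>\<^sub>G\<^sub>L {#\<alpha>#}"
            using less.IH[OF _ _ order_refl] none atomic(4) by (meson order_less_le_trans)
          then have "\<Gamma> \<turnstile>\<^sub>G\<^sub>L \<Delta>"
            unfolding \<Gamma>(1) \<Delta>' using \<Gamma>(2) atomic(2)
            by (intro GGL.boxGL) (auto simp: atomicR_def \<Delta>')
          with under show False by blast
        qed
        then obtain f where f:
          "\<And>\<alpha>. Box \<alpha> \<in># \<Delta> \<Longrightarrow> refutes below label (f \<alpha>) (Boxes \<Gamma>' + \<Gamma>' + {#Box \<alpha>#}) {#\<alpha>#}"
          by metis
        have "finite {\<alpha>. Box \<alpha> \<in># \<Delta>}"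
          using finite_vimageI[of "set_mset \<Delta>" Box] by (simp add: vimage_def inj_def)
        then obtain as where as: "set as = {\<alpha>. Box \<alpha> \<in># \<Delta>}"
          using finite_list by blast
        \<comment> \<open>The root makes the antecedent variables true and has, for each boxed
          succedent formula, a child refuting the corresponding modal premise.\<close>
        let ?t = "Node {q. PVar q \<in># \<Gamma>} (map f as)"
        have "refutes below label ?t \<Gamma> \<Delta>"
          unfolding refutes_def
        proof (intro conjI ballI)
          fix \<phi> assume \<phi>: "\<phi> \<in># \<Gamma>"
          then consider q where "\<phi> = PVar q" | \<psi> where "\<phi> = Box \<psi>" "\<psi> \<in># \<Gamma>'"
            using \<Gamma> by (auto simp: Boxes_def)
          then show "sat below label ?t \<phi>"
          proof cases
            case 1
            then show ?thesis using \<phi> by simp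
          next
            case 2
            \<comment> \<open>\<open>\<psi>\<close> covers the child itself,
              \<open>Box \<psi>\<close> everything below the child.\<close>
            then have "sat below label (f \<alpha>) \<psi> \<and> sat below label (f \<alpha>) (Box \<psi>)"
              if "\<alpha> \<in> set as" for \<alpha>
              using f[of \<alpha>] that as by (auto simp: refutes_def Boxes_def ball_Un)
            then show ?thesis by (auto simp: 2 below_Node_iff)
          qed
        next
          fix \<phi> assume \<phi>: "\<phi> \<in># \<Delta>"
          then consider q where "\<phi> = PVar q" | "\<phi> = Bot" | \<alpha> where "\<phi> = Box \<alpha>"
            using atomic(2) by (auto simp: atomicR_def)
          then show "\<not> sat below label ?t \<phi>"
          proof cases
            case 1
            then show ?thesis using \<phi> disjoint by auto
          next
            case 3
            then have "\<not> sat below label (f \<alpha>) \<alpha>" "\<alpha> \<in> set as"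
              using f[of \<alpha>] \<phi> as by (auto simp: refutes_def)
            then show ?thesis by (auto simp: 3 below_Node_iff)
          qed simp
        qed
        then show False using atomic(5) by blast
      qed
    qed
  next
    case (bot \<Gamma> \<Delta>)
    show ?case by (rule GGL.botL)
  next
    case (andL \<Gamma> \<Delta> \<alpha> \<beta>)
    show ?case
      by (intro GGL.andL andL.IH mono[OF andL.prems(2)])
        (use andL.prems(1,3) in \<open>auto simp: refutes_def\<close>)
  next
    case (orR \<Gamma> \<Delta> \<alpha> \<beta>)
    show ?case
      by (intro GGL.orR orR.IH mono[OF orR.prems(2)])
        (use orR.prems(1,3) in \<open>auto simp: refutes_def\<close>)
  next
    case (negR \<Gamma> \<Delta> \<alpha>)
    show ?case
      by (intro GGL.negR negR.IH mono[OF negR.prems(2)])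
        (use negR.prems(1,3) in \<open>auto simp: refutes_def\<close>)
  next
    case (negL \<Gamma> \<Delta> \<alpha>)
    show ?case
      by (intro GGL.negL negL.IH mono[OF negL.prems(2)])
        (use negL.prems(1,3) in \<open>auto simp: refutes_def\<close>)
  next
    case (andR \<Gamma> \<Delta> \<alpha> \<beta>)
    show ?case
      by (intro GGL.andR andR.IH mono[OF andR.prems(2)])
        (use andR.prems(1,3) in \<open>auto simp: refutes_def\<close>)
  next
    case (orL \<Gamma> \<Delta> \<alpha> \<beta>)
    show ?case
      by (intro GGL.orL orL.IH mono[OF orL.prems(2)])
        (use orL.prems(1,3) in \<open>auto simp: refutes_def\<close>)
  qed
qed

theorem GGL_complete: "(\<And>t. \<not> refutes below label t \<Gamma> \<Delta>) \<Longrightarrow> \<Gamma> \<turnstile>\<^sub>G\<^sub>L \<Delta>"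
  by (rule GGL_complete_bounded[OF _ order_refl order_refl]) (simp_all add: finite_Subfms)

section \<open>Bounded bisimulation and characteristic formulas\<close>

fun nbisim :: "'v set \<Rightarrow> ('w \<Rightarrow> 'w \<Rightarrow> bool) \<Rightarrow> ('w \<Rightarrow> 'v set) \<Rightarrow> nat \<Rightarrow> 'w \<Rightarrow> 'w \<Rightarrow> bool" where
  "nbisim P R V 0 a b \<longleftrightarrow> V a \<inter> P = V b \<inter> P"
| "nbisim P R V (Suc n) a b \<longleftrightarrow> V a \<inter> P = V b \<inter> P
     \<and> (\<forall>a'. R a a' \<longrightarrow> (\<exists>b'. R b b' \<and> nbisim P R V n a' b'))
     \<and> (\<forall>b'. R b b' \<longrightarrow> (\<exists>a'. R a a' \<and> nbisim P R V n a' b'))"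

lemma nbisim_atoms: "nbisim P R V n a b \<Longrightarrow> V a \<inter> P = V b \<inter> P"
  by (cases n) auto

lemma nbisim_antimono:
  assumes "nbisim P R V n a b" and "m \<le> n"
  shows "nbisim P R V m a b"
  using assms
proof (induction m arbitrary: n a b)
  case 0
  then show ?case by (auto dest: nbisim_atoms)
next
  case (Suc m)
  then obtain n' where n': "n = Suc n'" "m \<le> n'" by (cases n) auto
  show ?case using Suc.prems(1) Suc.IH[OF _ n'(2)] unfolding n' nbisim.simps by meson
qed

lemma nbisim_refl: "nbisim P R V n a a"
  by (induction n arbitrary: a) auto

text \<open>The list is an arbitrary enumeration of \<open>F\<close>; \<open>Neg Bot\<close> stands
  in for truth as the empty conjunction.\<close>

definition conjs :: "'v fm set \<Rightarrow> 'v fm" where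
  "conjs F = foldr And (SOME l. set l = F) (Neg Bot)"

definition disjs :: "'v fm set \<Rightarrow> 'v fm" where
  "disjs F = foldr Or (SOME l. set l = F) Bot"

lemma
  assumes "finite F"
  shows sat_conjs: "sat R V w (conjs F) \<longleftrightarrow> (\<forall>\<phi>\<in>F. sat R V w \<phi>)"
    and Var_conjs: "Var (conjs F) = (\<Union>\<phi>\<in>F. Var \<phi>)"
    and sat_disjs: "sat R V w (disjs F) \<longleftrightarrow> (\<exists>\<phi>\<in>F. sat R V w \<phi>)"
    and Var_disjs: "Var (disjs F) = (\<Union>\<phi>\<in>F. Var \<phi>)"
proof -
  have l: "set (SOME l. set l = F) = F"
    using finite_list[OF assms] by (rule someI_ex)
  have "sat R V w (foldr And l (Neg Bot)) \<longleftrightarrow> (\<forall>\<phi>\<in>set l. sat R V w \<phi>)"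
    "Var (foldr And l (Neg Bot)) = (\<Union>\<phi>\<in>set l. Var \<phi>)"
    "sat R V w (foldr Or l Bot) \<longleftrightarrow> (\<exists>\<phi>\<in>set l. sat R V w \<phi>)"
    "Var (foldr Or l Bot) = (\<Union>\<phi>\<in>set l. Var \<phi>)" for l
    by (induction l) auto
  note * = this[of "SOME l. set l = F", unfolded l]
  show "sat R V w (conjs F) \<longleftrightarrow> (\<forall>\<phi>\<in>F. sat R V w \<phi>)" "Var (conjs F) = (\<Union>\<phi>\<in>F. Var \<phi>)"
    "sat R V w (disjs F) \<longleftrightarrow> (\<exists>\<phi>\<in>F. sat R V w \<phi>)" "Var (disjs F) = (\<Union>\<phi>\<in>F. Var \<phi>)"
    unfolding conjs_def disjs_def using * by blast+
qed

definition literals :: "'v set \<Rightarrow> 'v set \<Rightarrow> 'v fm" where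
  "literals P L = And (conjs (PVar ` L)) (conjs ((\<lambda>q. Neg (PVar q)) ` (P - L)))"

text \<open>The cover modality (nabla): each member of \<open>X\<close> holds at some successor, and
  each successor satisfies some member.\<close>

definition successor_types :: "'v fm set \<Rightarrow> 'v fm" where
  "successor_types X = And (conjs ((\<lambda>\<phi>. Neg (Box (Neg \<phi>))) ` X)) (Box (disjs X))"

fun charfm :: "'v set \<Rightarrow> ('w \<Rightarrow> 'w \<Rightarrow> bool) \<Rightarrow> ('w \<Rightarrow> 'v set) \<Rightarrow> nat \<Rightarrow> 'w \<Rightarrow> 'v fm" where
  "charfm P R V 0 w = literals P (V w \<inter> P)"
| "charfm P R V (Suc n) w =
     And (literals P (V w \<inter> P)) (successor_types (charfm P R V n ` {v. R w v}))"

lemma sat_literals: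
  assumes "finite P"
  shows "sat R V w (literals P (L \<inter> P)) \<longleftrightarrow> V w \<inter> P = L \<inter> P"
  using assms by (auto simp: literals_def sat_conjs)

lemma Var_literals: "finite P \<Longrightarrow> L \<subseteq> P \<Longrightarrow> Var (literals P L) \<subseteq> P"
  by (auto simp: literals_def Var_conjs finite_subset)

text \<open>A formula of level \<open>n + 1\<close> is determined by a subset of \<open>P\<close>
  and a set of formulas of level \<open>n\<close>. Infinite sets of worlds therefore still give
  finite conjunctions and disjunctions.\<close>

lemma finite_range_charfm:
  assumes "finite P"
  shows "finite (range (charfm P R V n))"
proof (induction n)
  case 0
  have "range (charfm P R V 0) \<subseteq> literals P ` Pow P" by auto
  then show ?case by (rule finite_subset) (simp add: assms)
next
  case (Suc n)
  have "range (charfm P R V (Suc n)) \<subseteq>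
      (\<lambda>(L, X). And (literals P L) (successor_types X)) ` (Pow P \<times> Pow (range (charfm P R V n)))"
    by auto
  then show ?case by (rule finite_subset) (simp add: assms Suc)
qed

lemma finite_image_charfm: "finite P \<Longrightarrow> finite (charfm P R V n ` W)"
  by (rule finite_subset[OF _ finite_range_charfm]) auto

lemma Var_charfm:
  assumes "finite P"
  shows "Var (charfm P R V n w) \<subseteq> P"
proof (induction n arbitrary: w)
  case 0
  show ?case by (simp add: Var_literals assms)
next
  case (Suc n)
  have "Var (literals P (V w \<inter> P)) \<subseteq> P" by (simp add: Var_literals assms)
  then show ?case
    using Suc by (auto simp: successor_types_def Var_conjs Var_disjs finite_image_charfm assms)
qed

text \<open>The boxed disjunction in \<open>successor_types\<close> expresses the forth condition,
  the diamonds the back condition.\<close>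

lemma sat_charfm_iff_nbisim:
  assumes "finite P"
  shows "sat R V a (charfm P R V n b) \<longleftrightarrow> nbisim P R V n a b"
proof (induction n arbitrary: a b)
  case 0
  show ?case by (simp add: sat_literals assms)
next
  case (Suc n)
  show ?case
    by (auto simp: successor_types_def sat_literals sat_conjs sat_disjs finite_image_charfm assms Suc)
qed

section \<open>Amalgamation\<close>

text \<open>In a pair \<open>(a, b)\<close>, \<open>a\<close> decides the formulas without
  \<open>p\<close> and \<open>b\<close> those in \<open>S\<close>; \<open>P\<close> contains the
  variables on which both must agree.\<close>

locale amalgam =
  fixes R :: "'w \<Rightarrow> 'w \<Rightarrow> bool" and V :: "'w \<Rightarrow> 'v set" and S :: "'v fm set" and p :: 'v
    and P :: "'v set"
  assumes frame: "GL_frame R" and finite_S: "finite S"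
    and S_closed: "\<And>\<phi>. \<phi> \<in> S \<Longrightarrow> subfms \<phi> \<subseteq> S"
    and S_vars: "\<And>q. PVar q \<in> S \<Longrightarrow> q \<noteq> p \<Longrightarrow> q \<in> P"
begin

definition boxed :: "'w \<Rightarrow> 'v fm set" where
  "boxed b = {\<phi> \<in> S. \<phi> \<in> range Box \<and> sat R V b \<phi>}"

text \<open>Each failing box pays for two levels: one is lost between a base and the pair it
  supports, one is spent on a back step. The last 1 allows forth steps from a base when every box of
  \<open>S\<close> holds.\<close>

definition depth :: "'w \<Rightarrow> nat" where
  "depth b = 2 * card ((S \<inter> range Box) - boxed b) + 1"

text \<open>
  The base \<open>(a0, b0)\<close> absorbs steps that leave \<open>boxed\<close> unchanged: by transitivity a successor of \<open>a\<close>
  is one of \<open>a0\<close>, so it can be matched from the base without using up bisimulation depth.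
\<close>

definition good :: "'w \<times> 'w \<Rightarrow> bool" where
  "good = (\<lambda>(a, b). nbisim P R V (depth b - 1) a b \<and>
     (\<exists>a0 b0. R\<^sup>=\<^sup>= a0 a \<and> R\<^sup>=\<^sup>= b0 b \<and> boxed b0 = boxed b \<and> nbisim P R V (depth b) a0 b0))"

text \<open>\<open>R\<close> is required only between first components, since a match found from the
  base lies above \<open>b0\<close> but perhaps not above \<open>b\<close>. Keeping the boxes as
  well as their bodies makes the relation transitive.\<close>

definition pair_rel :: "'w \<times> 'w \<Rightarrow> 'w \<times> 'w \<Rightarrow> bool" where
  "pair_rel = (\<lambda>(a, b) (a', b'). good (a', b') \<and> R a a' \<and>
     (\<forall>\<psi>. Box \<psi> \<in> boxed b \<longrightarrow> Box \<psi> \<in> boxed b' \<and> sat R V b' \<psi>))"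

definition pair_val :: "'w \<times> 'w \<Rightarrow> 'v set" where
  "pair_val = (\<lambda>(a, b). (V a - {p}) \<union> (V b \<inter> {p}))"

lemma GL_frame_pair_rel: "GL_frame pair_rel"
  unfolding GL_frame_def
proof
  show "transp pair_rel"
    by (rule transpI) (auto simp: pair_rel_def intro: GL_frame_trans[OF frame])
  have "wfp (\<lambda>x y. R\<inverse>\<inverse> (fst x) (fst y))"
    using frame unfolding GL_frame_def by (metis wfp_on_image wfp_on_subset top_greatest)
  then show "wfp (pair_rel\<inverse>\<inverse>)"
    by (rule wfp_subset) (auto simp: pair_rel_def)
qed

lemma boxed_step:
  assumes "R b b'" and "Box \<psi> \<in> boxed b"
  shows "Box \<psi> \<in> boxed b' \<and> sat R V b' \<psi>"
  using assms GL_frame_trans[OF frame assms(1)] by (auto simp: boxed_def)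

lemma boxed_mono: "R b b' \<Longrightarrow> boxed b \<subseteq> boxed b'"
proof
  fix \<phi> assume "R b b'" "\<phi> \<in> boxed b"
  moreover from this obtain \<psi> where "\<phi> = Box \<psi>" by (auto simp: boxed_def)
  ultimately show "\<phi> \<in> boxed b'" using boxed_step by blast
qed

lemma depth_less:
  assumes "boxed b \<subset> boxed b'"
  shows "depth b' + 2 \<le> depth b"
proof -
  have "card ((S \<inter> range Box) - boxed b') < card ((S \<inter> range Box) - boxed b)"
    by (rule psubset_card_mono) (use assms finite_S in \<open>auto simp: boxed_def\<close>)
  then show ?thesis by (simp add: depth_def)
qed

lemma depth_cong: "boxed b = boxed b' \<Longrightarrow> depth b = depth b'"
  by (simp add: depth_def)

text \<open>Such a pair is its own base.\<close>

lemma good_if_nbisim: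
  assumes "nbisim P R V n a b" and "depth b \<le> n"
  shows "good (a, b)"
  unfolding good_def
  using nbisim_antimono[OF assms] nbisim_antimono[OF assms(1), of "depth b - 1"] assms(2)
  by auto

text \<open>The match for \<open>a'\<close> is sought from the base, which has one level of
  bisimulation more than the pair itself.\<close>

lemma good_forth:
  assumes "good (a, b)" and "R a a'"
  shows "\<exists>b'. pair_rel (a, b) (a', b')"
proof -
  obtain a0 b0 where base: "R\<^sup>=\<^sup>= a0 a" "R\<^sup>=\<^sup>= b0 b" "boxed b0 = boxed b"
      "nbisim P R V (depth b) a0 b0"
    using assms(1) by (auto simp: good_def)
  have "R a0 a'" using base(1) assms(2) GL_frame_trans[OF frame] by auto
  moreover have "depth b = Suc (depth b - 1)" by (simp add: depth_def)
  ultimately obtain b' where b': "R b0 b'" "nbisim P R V (depth b - 1) a' b'"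
    using base(4) by (metis nbisim.simps(2))
  have "good (a', b')"
  \<comment> \<open>If no box becomes true, the old base also supports the new pair; otherwise the
    required depth drops by two and the remaining bisimulation makes the new pair its own
    base.\<close>
  proof (cases "boxed b' = boxed b0")
    case True
    then have "depth b' = depth b" using base(3) depth_cong by metis
    then show ?thesis using b' base True \<open>R a0 a'\<close> unfolding good_def by auto
  next
    case False
    then have "depth b' + 2 \<le> depth b"
      using depth_less[of b b'] boxed_mono[OF b'(1)] base(3) by blast
    then show ?thesis using good_if_nbisim[OF b'(2)] by simp
  qed
  then show ?thesis
    using assms(2) boxed_step[OF b'(1)] base(3) unfolding pair_rel_def by auto
qed

text \<open>At a maximal witness \<open>Box \<psi>\<close> becomes true, so the required depth drops
  by two, which pays for a step from the pair itself.\<close>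

lemma good_back:
  assumes "good (a, b)" and "Box \<psi> \<in> S" and "\<not> sat R V b (Box \<psi>)"
  shows "\<exists>a' b'. pair_rel (a, b) (a', b') \<and> \<not> sat R V b' \<psi>"
proof -
  obtain b' where b': "R b b'" "\<not> sat R V b' \<psi>" "sat R V b' (Box \<psi>)"
    using GL_frame_maximal_witness[OF frame assms(3)] .
  then have "Box \<psi> \<in> boxed b' - boxed b" using assms(2,3) by (auto simp: boxed_def)
  then have le: "depth b' + 2 \<le> depth b"
    using depth_less[of b b'] boxed_mono[OF b'(1)] by blast
  \<comment> \<open>By \<open>le\<close>, \<open>depth b\<close> is at least 2, so the truncated
    subtraction is exact.\<close>
  then have "depth b - 1 = Suc (depth b - 2)" by simp
  then have "nbisim P R V (Suc (depth b - 2)) a b"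
    using assms(1) by (simp add: good_def)
  then obtain a' where a': "R a a'" "nbisim P R V (depth b - 2) a' b'"
    using b'(1) by auto
  have "good (a', b')" using good_if_nbisim[OF a'(2)] le by simp
  then show ?thesis
    using a' b' boxed_step[OF b'(1)] unfolding pair_rel_def by auto
qed

text \<open>For boxes, \<open>good_back\<close> supplies the refuting pairs, while the clause on
  \<open>boxed\<close> in \<open>pair_rel\<close> transfers the true ones.\<close>

lemma sat_pair_snd:
  assumes "\<phi> \<in> S" and "good (a, b)"
  shows "sat pair_rel pair_val (a, b) \<phi> \<longleftrightarrow> sat R V b \<phi>"
  using assms
proof (induction \<phi> arbitrary: a b)
  case (PVar q)
  have "V a \<inter> P = V b \<inter> P"
    using PVar.prems(2) nbisim_atoms[of P R V _ a b] unfolding good_def prod.case by blast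
  then show ?case using S_vars[OF PVar.prems(1)] by (auto simp: pair_val_def)
next
  case (Box \<psi>)
  have \<psi>: "\<psi> \<in> S" using S_closed[OF Box.prems(1)] by auto
  show ?case
  proof
    assume L: "sat pair_rel pair_val (a, b) (Box \<psi>)"
    show "sat R V b (Box \<psi>)"
    proof (rule ccontr)
      assume "\<not> sat R V b (Box \<psi>)"
      then obtain a' b' where ab': "pair_rel (a, b) (a', b')" "\<not> sat R V b' \<psi>"
        using good_back[OF Box.prems(2,1)] by blast
      then have "good (a', b')" by (simp add: pair_rel_def)
      then show False using L ab' Box.IH[OF \<psi>] by auto
    qed
  next
    assume "sat R V b (Box \<psi>)"
    then have "Box \<psi> \<in> boxed b" using Box.prems(1) by (simp add: boxed_def)
    then show "sat pair_rel pair_val (a, b) (Box \<psi>)"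
      using Box.IH[OF \<psi>] by (auto simp: pair_rel_def)
  qed
next
  case (Neg \<phi>)
  then show ?case using S_closed[OF Neg.prems(1)] by (auto dest!: subsetD[OF _ subfms_refl])
next
  case (And \<phi> \<psi>)
  then show ?case using S_closed[OF And.prems(1)] by (auto dest!: subsetD[OF _ subfms_refl])
next
  case (Or \<phi> \<psi>)
  then show ?case using S_closed[OF Or.prems(1)] by (auto dest!: subsetD[OF _ subfms_refl])
qed simp

text \<open>Up to \<open>p\<close>, the first projection is a bisimulation: pair steps project to
  \<open>R\<close>, and \<open>good_forth\<close> lifts the steps of \<open>R\<close>.\<close>

lemma sat_pair_fst:
  assumes "p \<notin> Var \<phi>" and "good (a, b)"
  shows "sat pair_rel pair_val (a, b) \<phi> \<longleftrightarrow> sat R V a \<phi>"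
  using assms
proof (induction \<phi> arbitrary: a b)
  case (PVar q)
  then show ?case by (auto simp: pair_val_def)
next
  case (Box \<psi>)
  have \<psi>: "p \<notin> Var \<psi>" using Box.prems(1) by simp
  have "sat pair_rel pair_val (a', b') \<psi> \<longleftrightarrow> sat R V a' \<psi>" "R a a'"
    if "pair_rel (a, b) (a', b')" for a' b'
    using that Box.IH[OF \<psi>, of a' b'] by (auto simp: pair_rel_def)
  then show ?case using good_forth[OF Box.prems(2)] by (auto; metis)
qed auto

end

section \<open>Uniform interpolation\<close>

lemma Subfms_closed: "\<phi> \<in> Subfms \<Gamma> \<Longrightarrow> subfms \<phi> \<subseteq> Subfms \<Gamma>"
proof -
  have "\<phi> \<in> subfms \<psi> \<Longrightarrow> subfms \<phi> \<subseteq> subfms \<psi>" for \<psi> by (induction \<psi>) auto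
  then show "\<phi> \<in> Subfms \<Gamma> \<Longrightarrow> subfms \<phi> \<subseteq> Subfms \<Gamma>" unfolding Subfms_def by blast
qed

lemma PVar_in_Subfms: "PVar q \<in> Subfms \<Gamma> \<Longrightarrow> q \<in> Vars \<Gamma>"
proof -
  have "PVar q \<in> subfms \<psi> \<Longrightarrow> q \<in> Var \<psi>" for \<psi> by (induction \<psi>) auto
  then show "PVar q \<in> Subfms \<Gamma> \<Longrightarrow> q \<in> Vars \<Gamma>" unfolding Subfms_def Vars_def by blast
qed

lemma finite_Vars: "finite (Vars \<Gamma>)"
proof -
  have "finite (Var \<phi>)" for \<phi> :: "'a fm" by (induction \<phi>) auto
  then show ?thesis by (simp add: Vars_def)
qed

theorem theorem3p1:
  fixes \<Gamma> \<Delta> :: "'v fm multiset" and p :: 'v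
  shows "\<exists>A :: 'v fm.
           Var A \<subseteq> Vars (\<Gamma> + \<Delta>) - {p} \<and>
           \<Gamma> + {#A#} \<turnstile>\<^sub>G\<^sub>L \<Delta> \<and>
           (\<forall>\<Phi> \<Psi> :: 'v fm multiset.
              p \<notin> Vars \<Phi> \<longrightarrow> p \<notin> Vars \<Psi> \<longrightarrow>
              \<Phi> + \<Gamma> \<turnstile>\<^sub>G\<^sub>L \<Delta> + \<Psi> \<longrightarrow> \<Phi> \<turnstile>\<^sub>G\<^sub>L {#A#} + \<Psi>)"
proof -
  define P where "P = Vars (\<Gamma> + \<Delta>) - {p}"
  define S where "S = Subfms (\<Gamma> + \<Delta>)"
  \<comment> \<open>An upper bound for \<open>depth\<close>, so that \<open>n\<close>-bisimilarity
    makes any pair good.\<close>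
  define n where "n = 2 * card (S \<inter> range Box) + 1"
  define T where "T = {t. refutes below label t \<Gamma> \<Delta>}"
  define A where "A = Neg (disjs (charfm P below label n ` T))"
  have finP: "finite P" by (simp add: P_def finite_Vars)
  have sat_A: "sat below label k A \<longleftrightarrow> (\<forall>m\<in>T. \<not> nbisim P below label n k m)" for k
    by (simp add: A_def sat_disjs finite_image_charfm finP sat_charfm_iff_nbisim)
  interpret amalgam below label S p P
  proof
    show "finite S" unfolding S_def by (rule finite_Subfms)
    show "\<And>\<phi>. \<phi> \<in> S \<Longrightarrow> subfms \<phi> \<subseteq> S" unfolding S_def by (rule Subfms_closed)
    show "\<And>q. PVar q \<in> S \<Longrightarrow> q \<noteq> p \<Longrightarrow> q \<in> P"
      unfolding S_def P_def by (auto dest!: PVar_in_Subfms simp del: Subfms_simps)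
  qed (rule GL_frame_below)
  have "Var A \<subseteq> P"
    using Var_charfm[OF finP, of below label n]
    by (auto simp: A_def Var_disjs finite_image_charfm finP)
  moreover have "\<Gamma> + {#A#} \<turnstile>\<^sub>G\<^sub>L \<Delta>"
  proof (rule GGL_complete)
    fix t
    \<comment> \<open>A tree refuting the given sequent belongs to \<open>T\<close> and is bisimilar
      to itself, so \<open>A\<close> fails there.\<close>
    show "\<not> refutes below label t (\<Gamma> + {#A#}) \<Delta>"
      using sat_A[of t] nbisim_refl[of P below label n t] by (auto simp: refutes_def T_def)
  qed
  moreover have "\<Phi> \<turnstile>\<^sub>G\<^sub>L {#A#} + \<Psi>"
    if p: "p \<notin> Vars \<Phi>" "p \<notin> Vars \<Psi>" and d: "\<Phi> + \<Gamma> \<turnstile>\<^sub>G\<^sub>L \<Delta> + \<Psi>" for \<Phi> \<Psi>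
  proof (rule GGL_complete, rule notI)
    fix k assume k: "refutes below label k \<Phi> ({#A#} + \<Psi>)"
    \<comment> \<open>Failure of \<open>A\<close> at \<open>k\<close> means that \<open>k\<close>
      shares its depth-\<open>n\<close> type with some tree in \<open>T\<close>.\<close>
    then obtain m where m: "m \<in> T" "nbisim P below label n k m"
      using sat_A[of k] by (auto simp: refutes_def)
    have "depth m \<le> n"
      unfolding depth_def n_def using card_mono[OF _ Diff_subset] finite_S by auto
    then have good: "good (k, m)" using good_if_nbisim m(2) by blast
    have "\<forall>\<phi>\<in>#\<Gamma> + \<Delta>. \<phi> \<in> S" unfolding S_def Subfms_def using subfms_refl by blast
    then have "refutes pair_rel pair_val (k, m) \<Gamma> \<Delta>"
      using m(1) sat_pair_snd[OF _ good] by (auto simp: T_def refutes_def)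
    moreover have "refutes pair_rel pair_val (k, m) \<Phi> \<Psi>"
      using k p sat_pair_fst[OF _ good] by (auto simp: refutes_def Vars_def)
    \<comment> \<open>The pair refutes the first sequent through \<open>m\<close> and the second
      through \<open>k\<close>, hence their union, against soundness.\<close>
    ultimately have "refutes pair_rel pair_val (k, m) (\<Phi> + \<Gamma>) (\<Delta> + \<Psi>)"
      by (auto simp: refutes_def)
    then show False using GGL_sound[OF d GL_frame_pair_rel] by blast
  qed
  ultimately show ?thesis unfolding P_def by blast
qed

end
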